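(* There is an absolute constant $C>0$ such that for every integer $t\ge 6$ there exists a strongly connected digraph $H_t$ of order $n=t^2+1$ with minimum in-degree $3$ such that $0<\ell_s(H_t)\le C t$ (that is, $0<\ell_s(H_t)=O(t)$), where $\ell_s(H_t)$ denotes the maximum number of leaves in an out-branching of $H_t$.
   Context: Digraphs are finite, without loops and without parallel arcs (directed 2-cycles are allowed). The order of a digraph is its number of vertices. The in-degree of a vertex $v$ is the number of vertices $u$ such that $uv$ is an arc. A subdigraph $T$ of a digraph $D$ is an out-tree if $T$ is an oriented tree (its underlying undirected graph is a tree) with exactly one vertex of in-degree zero in $T$, called the root. An out-branching of $D$ is an out-tree $T$ in $D$ with $V(T)=V(D)$. The leaves of $T$ are the vertices of out-degree zero in $T$. $\ell_s(D)$ is the maximum number of leaves in an out-branching of $D$ (and $\ell_s(D)=0$ if $D$ has no out-branching). *)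

theory Defs
  imports Complex_Main "Graph_Theory.Graph_Theory"
begin

text \<open>
  The predicates \<open>forest\<close> and \<open>tree\<close> of \<open>Digraph_Component\<close> forbid only directed cycles, so
  that, e.g., a transitive tournament on three vertices is a \<open>tree\<close> in their sense; they are
  therefore not used here. Undirected cycles are taken in the symmetric digraph
  \<open>mk_symmetric T\<close>, in which every edge gives rise to a closed walk \<open>u, v, u\<close>; hence the
  restriction to cycles of length at least 3.
\<close>

definition underlying_acyclic :: "('a, 'b) pre_digraph \<Rightarrow> bool" where
  "underlying_acyclic T \<longleftrightarrow>
     \<not> (\<exists>p. pre_digraph.cycle (with_proj (mk_symmetric T)) p \<and> 3 \<le> length p)"

definition underlying_tree :: "('a, 'b) pre_digraph \<Rightarrow> bool" where
  "underlying_tree T \<longleftrightarrow> connected T \<and> underlying_acyclic T"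

text \<open>
  \<open>mk_symmetric\<close> identifies antiparallel arcs, so that ``oriented'' (no directed 2-cycles) has to
  be required separately; \<open>digraph\<close> excludes loops and parallel arcs.
\<close>

definition oriented_tree :: "('a, 'b) pre_digraph \<Rightarrow> bool" where
  "oriented_tree T \<longleftrightarrow>
     digraph T \<and> (\<forall>u v. u \<rightarrow>\<^bsub>T\<^esub> v \<longrightarrow> \<not> v \<rightarrow>\<^bsub>T\<^esub> u) \<and> underlying_tree T"

definition out_tree :: "('a, 'b) pre_digraph \<Rightarrow> bool" where
  "out_tree T \<longleftrightarrow> oriented_tree T \<and> (\<exists>!r. r \<in> verts T \<and> in_degree T r = 0)"

definition out_branching :: "('a, 'b) pre_digraph \<Rightarrow> ('a, 'b) pre_digraph \<Rightarrow> bool" where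
  "out_branching T D \<longleftrightarrow> out_tree T \<and> spanning T D"

definition leaves :: "('a, 'b) pre_digraph \<Rightarrow> 'a set" where
  "leaves T = {v \<in> verts T. out_degree T v = 0}"

text \<open>
  For a finite \<open>D\<close> the set under \<open>Max\<close> is finite, since \<open>spanning\<close> forces the \<open>tail\<close> and \<open>head\<close>
  maps of \<open>T\<close> to be those of \<open>D\<close>.
\<close>

definition ell_s :: "('a, 'b) pre_digraph \<Rightarrow> nat" where
  "ell_s D =
     (if \<exists>T. out_branching T D then Max {card (leaves T) | T. out_branching T D} else 0)"

definition min_in_degree :: "('a, 'b) pre_digraph \<Rightarrow> nat" where
  "min_in_degree D = Min (in_degree D ` verts D)"

end

theory Submission
  imports Defs
begin

text \<open>
  The digraph consists of \<open>t\<close> paths of \<open>t\<close> vertices each, all issuing from a common vertex \<open>0\<close>.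
  Along a path one can go back arbitrarily far but forward only by single steps, except that the
  last four vertices of each path span a complete digraph, which provides in-degree 3. If a path
  does not contain the root of an out-branching, then the branching enters every final segment
  of the path, hence uses all forward steps up to the last four vertices. So it has at most four
  leaves on each such path, at most \<open>t\<close> leaves on the path of the root, and possibly the leaf
  \<open>0\<close>.
\<close>

section \<open>Trees\<close>

text \<open>A directed cycle is also a cycle of the symmetric digraph. Since loops and directed
  2-cycles are excluded, its length is at least 3, which \<open>underlying_acyclic\<close>
  forbids.\<close>

lemma oriented_underlying_acyclic_imp_acyclic:
  assumes "digraph T" and oriented: "\<And>u v. u \<rightarrow>\<^bsub>T\<^esub> v \<Longrightarrow> \<not> v \<rightarrow>\<^bsub>T\<^esub> u"
    and "underlying_acyclic T"
  shows "acyclic (arcs_ends T)"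
proof (rule acyclicI, intro allI notI)
  interpret T: digraph T by fact
  \<comment> \<open>\<open>P\<close> replaces each arc by its pair of ends. Its cycles are then
    lists of the same type as those of \<open>mk_symmetric T\<close> and can be transferred
    unchanged.\<close>
  define P where "P = \<lparr>pverts = verts T, parcs = arcs_ends T\<rparr>"
  interpret P: pair_wf_digraph P
    by unfold_locales (auto simp: P_def arcs_ends_conv)
  interpret S: pair_digraph "mk_symmetric T" ..
  fix u assume "(u, u) \<in> (arcs_ends T)\<^sup>+"
  then have "u \<rightarrow>\<^sup>+\<^bsub>with_proj P\<^esub> u" by (simp add: P_def)
  then obtain p where "P.awalk u p u" "p \<noteq> []"
    by (auto simp: P.reachable1_awalk)
  then have "P.closed_w p" by (auto simp: P.closed_w_def)
  then obtain q where q: "P.cycle q" using P.closed_w_imp_cycle by blast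
  then obtain w where w: "set q \<subseteq> arcs_ends T" "pcas w q w" "q \<noteq> []"
    unfolding P.cycle_def P.awalk_def by (auto simp: P_def)
  have "3 \<le> length q"
  proof (rule ccontr)
    assume "\<not> 3 \<le> length q"
    moreover have "length q \<noteq> 0" using \<open>q \<noteq> []\<close> by simp
    ultimately have "length q = 1 \<or> length q = 2" by arith
    then show False
    proof
      assume "length q = 1"
      then obtain e where "q = [e]" by (auto simp: length_Suc_conv)
      \<comment> \<open>A loop is its own reverse, so \<open>oriented\<close> excludes this case
        too.\<close>
      with w have "w \<rightarrow>\<^bsub>T\<^esub> w" by (cases e) auto
      then show False using oriented by blast
    next
      assume "length q = 2"
      then obtain e f where "q = [e, f]" by (auto simp: length_Suc_conv numeral_2_eq_2)
      with w have "w \<rightarrow>\<^bsub>T\<^esub> snd e" "snd e \<rightarrow>\<^bsub>T\<^esub> w" by (cases e, cases f, auto)+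
      then show False using oriented by blast
    qed
  qed
  moreover have "subgraph (with_proj P) (with_proj (mk_symmetric T))"
    unfolding subgraph_def using P.wf_digraph S.wf_digraph
    by (auto simp: P_def parcs_mk_symmetric arcs_ends_conv)
  then have "S.cycle q" using q by (rule S.subgraph_cycle)
  ultimately show False using assms(3) unfolding underlying_acyclic_def by blast
qed

text \<open>Finiteness and acyclicity give a vertex of \<open>S\<close> none of whose in-neighbours
  lies in \<open>S\<close>. As this vertex is not a root, it has an in-neighbour, necessarily
  outside \<open>S\<close>.\<close>

lemma arc_enters_rootless_set:
  assumes "digraph T" "acyclic (arcs_ends T)" "S \<subseteq> verts T" "S \<noteq> {}"
    and no_root: "\<And>v. v \<in> S \<Longrightarrow> in_degree T v \<noteq> 0"
  obtains u v where "u \<rightarrow>\<^bsub>T\<^esub> v" "v \<in> S" "u \<notin> S"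
proof -
  interpret T: digraph T by fact
  have "finite (arcs_ends T)" by (simp add: arcs_ends_def)
  then have "wf (arcs_ends T)" using assms(2) by (rule finite_acyclic_wf)
  then obtain v where v: "v \<in> S" "\<And>u. u \<rightarrow>\<^bsub>T\<^esub> v \<Longrightarrow> u \<notin> S"
    using \<open>S \<noteq> {}\<close> by (metis wfE_min ex_in_conv)
  have "in_arcs T v \<noteq> {}" using no_root[OF v(1)] by (metis card.empty in_degree_def)
  then obtain e where "e \<in> in_arcs T v" by blast
  then have "e \<in> arcs T" "head T e = v" by auto
  then have "tail T e \<rightarrow>\<^bsub>T\<^esub> v" by (auto simp: arcs_ends_conv)
  then show thesis using v that by blast
qed

section \<open>Trees given by a parent function\<close>

text \<open>A tree with root 0, in which every other vertex \<open>v\<close> has parent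
  \<open>f v\<close>. Arcs are pairs with projections \<open>fst\<close> and \<open>snd\<close>, as
  in \<open>H_graph\<close>, so that such a tree can be a subgraph of it.\<close>

definition parent_graph :: "nat \<Rightarrow> (nat \<Rightarrow> nat) \<Rightarrow> (nat, nat \<times> nat) pre_digraph" where
  "parent_graph n f =
     \<lparr>verts = {..n}, arcs = (\<lambda>v. (f v, v)) ` {1..n}, tail = fst, head = snd\<rparr>"

context
  fixes n :: nat and f :: "nat \<Rightarrow> nat"
  assumes parent_less: "\<And>v. 1 \<le> v \<Longrightarrow> v \<le> n \<Longrightarrow> f v < v"
begin

lemma digraph_parent_graph: "digraph (parent_graph n f)"
proof unfold_locales
  fix e assume "e \<in> arcs (parent_graph n f)"
  then obtain v where "e = (f v, v)" "1 \<le> v" "v \<le> n" by (auto simp: parent_graph_def)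
  then show "tail (parent_graph n f) e \<in> verts (parent_graph n f)"
    "tail (parent_graph n f) e \<noteq> head (parent_graph n f) e"
    using parent_less[of v] by (simp_all add: parent_graph_def)
qed (auto simp: parent_graph_def arc_to_ends_def)

lemma dominates_parent_graph_iff:
  "u \<rightarrow>\<^bsub>parent_graph n f\<^esub> v \<longleftrightarrow> 1 \<le> v \<and> v \<le> n \<and> u = f v"
  by (auto simp: arcs_ends_conv parent_graph_def)

lemma reachable_parent_graph: "v \<le> n \<Longrightarrow> 0 \<rightarrow>\<^sup>*\<^bsub>parent_graph n f\<^esub> v"
proof (induction v rule: less_induct)
  case (less v)
  interpret digraph "parent_graph n f" by (rule digraph_parent_graph)
  show ?case
  proof (cases "v = 0")
    case True
    have "0 \<in> verts (parent_graph n f)" by (simp add: parent_graph_def)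
    then show ?thesis using True by simp
  next
    case False
    then have "0 \<rightarrow>\<^sup>*\<^bsub>parent_graph n f\<^esub> f v" using less parent_less[of v] by simp
    moreover have "f v \<rightarrow>\<^bsub>parent_graph n f\<^esub> v"
      using False less.prems by (simp add: dominates_parent_graph_iff)
    ultimately show ?thesis by (rule reachable_adj_trans)
  qed
qed

lemma connected_parent_graph: "connected (parent_graph n f)"
  unfolding connected_def
proof (rule strongly_connectedI)
  interpret digraph "parent_graph n f" by (rule digraph_parent_graph)
  interpret S: pair_digraph "mk_symmetric (parent_graph n f)" ..
  let ?S = "with_proj (mk_symmetric (parent_graph n f))"
  show "verts ?S \<noteq> {}" by (auto simp: parent_graph_def)
  fix u v assume "u \<in> verts ?S" "v \<in> verts ?S"
  then have reach: "0 \<rightarrow>\<^sup>*\<^bsub>?S\<^esub> u" "0 \<rightarrow>\<^sup>*\<^bsub>?S\<^esub> v"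
    by (auto intro!: reachable_mk_symmetricI reachable_parent_graph)
      (simp_all add: parent_graph_def)
  have "u \<rightarrow>\<^sup>*\<^bsub>?S\<^esub> 0"
    using symmetric_mk_symmetric reach(1) by (rule symmetric_reachable)
  then show "u \<rightarrow>\<^sup>*\<^bsub>?S\<^esub> v" using reach(2) by (rule S.reachable_trans)
qed

text \<open>Both neighbours of the largest vertex of a cycle would have to be its parent.\<close>

lemma underlying_acyclic_parent_graph: "underlying_acyclic (parent_graph n f)"
  unfolding underlying_acyclic_def
proof (intro notI, elim exE conjE)
  interpret digraph "parent_graph n f" by (rule digraph_parent_graph)
  interpret S: pair_digraph "mk_symmetric (parent_graph n f)" ..
  fix p assume "S.cycle p" and len: "3 \<le> length p"
  then obtain u where u: "S.awalk u p u" "distinct (tl (pawalk_verts u p))" "p \<noteq> []"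
    unfolding S.cycle_def by auto
  \<comment> \<open>A cycle visits its start vertex twice, so only the tail of its vertex list is
    distinct; this tail is the list of heads of the arcs.\<close>
  have "pawalk_verts u p = fst (hd p) # map snd p"
    using S.awalk_verts_conv'[of u p u] u by (auto simp: S.awalk_def)
  with u have inj: "distinct (map snd p)" by simp
  define L where "L = length p"
  have L: "3 \<le> L" using len by (simp add: L_def)
  \<comment> \<open>Reading indices modulo \<open>L\<close> makes the vertex sequence periodic, so
    that every vertex has a predecessor and a successor without a special case at the ends of the
    list.\<close>
  define b where "b k = snd (p ! (k mod L))" for k
  have cas: "pcas x q y \<Longrightarrow> Suc k < length q \<Longrightarrow> fst (q ! Suc k) = snd (q ! k)"
    for x y :: nat and q k
  proof (induction q arbitrary: x k)
    case (Cons e q)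
    then show ?case by (cases k; cases q) auto
  qed simp
  have ends: "pcas x q y \<Longrightarrow> q \<noteq> [] \<Longrightarrow> fst (q ! 0) = x \<and> snd (last q) = y"
    for x y :: nat and q
    by (induction q arbitrary: x) auto
  have fst_p: "fst (p ! (Suc k mod L)) = b k" for k
  proof (cases "Suc (k mod L) = L")
    case True
    then have "Suc k mod L = 0" by (simp add: mod_Suc)
    moreover have "snd (last p) = b k"
      using True u(3) by (metis L_def b_def diff_Suc_1 last_conv_nth)
    ultimately show ?thesis using ends[of u p u] u by (simp add: S.awalk_def)
  next
    case False
    then have "Suc k mod L = Suc (k mod L)" by (simp add: mod_Suc)
    moreover have "Suc (k mod L) < L"
      using False L by (metis Suc_lessI mod_less_divisor not_gr_zero not_numeral_le_zero)
    ultimately show ?thesis using cas[of u p u "k mod L"] u by (simp add: S.awalk_def b_def L_def)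
  qed
  have adj: "(b k, b (Suc k)) \<in> parcs (mk_symmetric (parent_graph n f))" for k
  proof -
    have "Suc k mod L < L" using L by (intro mod_less_divisor) simp
    then have "p ! (Suc k mod L) \<in> set p" by (simp add: L_def)
    moreover have "p ! (Suc k mod L) = (b k, b (Suc k))"
      using fst_p[of k] by (simp add: prod_eq_iff b_def)
    ultimately show ?thesis using u(1) by (auto simp: S.awalk_def)
  qed
  have parent: "(y < x \<and> y = f x) \<or> (x < y \<and> x = f y)"
    if "(x, y) \<in> parcs (mk_symmetric (parent_graph n f))" for x y
    using that by (auto simp: parcs_mk_symmetric parent_graph_def parent_less)
  have "Max (b ` {..<L}) \<in> b ` {..<L}" using L by (intro Max_in) (auto simp: lessThan_empty_iff)
  then obtain j where j: "j < L" "b j = Max (b ` {..<L})" by auto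
  have max: "b k \<le> b j" for k
  proof -
    have "b k = b (k mod L)" by (simp add: b_def)
    moreover have "b (k mod L) \<le> b j" unfolding j(2) using L by (intro Max_ge) auto
    ultimately show ?thesis by simp
  qed
  \<comment> \<open>The cyclic predecessor of \<open>j\<close>; adding \<open>L\<close> keeps the
    subtraction from truncating at \<open>j = 0\<close>.\<close>
  define i where "i = j + L - 1"
  have "b (Suc i) = b j" using L by (simp add: i_def b_def)
  then have "b i = f (b j)" using parent[OF adj[of i]] max[of i] by auto
  moreover have "b (Suc j) = f (b j)" using parent[OF adj[of j]] max[of "Suc j"] by auto
  ultimately have "snd (p ! (i mod L)) = snd (p ! (Suc j mod L))" by (simp add: b_def)
  then have "i mod L = Suc j mod L"
    using inj mod_less_divisor[of L] L
    by (metis L_def length_map less_le_trans nth_eq_iff_index_eq nth_map zero_less_numeral)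
  \<comment> \<open>The two neighbours of \<open>b j\<close> coincide, although their indices differ
    by \<open>L - 2\<close>, which lies strictly between 0 and \<open>L\<close>.\<close>
  moreover have "i = Suc j + (L - 2)" using L by (simp add: i_def)
  ultimately have "L dvd L - 2"
    by (metis add_diff_cancel_left' mod_eq_dvd_iff_nat le_add1)
  then show False using L by (auto dest: dvd_imp_le)
qed

lemma in_degree_parent_graph:
  assumes "v \<le> n"
  shows "in_degree (parent_graph n f) v = (if v = 0 then 0 else 1)"
proof -
  have "in_arcs (parent_graph n f) v = (if v = 0 then {} else {(f v, v)})"
    using assms by (auto simp: in_arcs_def parent_graph_def)
  then show ?thesis by (simp add: in_degree_def)
qed

lemma out_tree_parent_graph: "out_tree (parent_graph n f)"
  unfolding out_tree_def oriented_tree_def underlying_tree_def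
proof (intro conjI allI impI digraph_parent_graph connected_parent_graph
    underlying_acyclic_parent_graph)
  show "\<not> v \<rightarrow>\<^bsub>parent_graph n f\<^esub> u" if "u \<rightarrow>\<^bsub>parent_graph n f\<^esub> v" for u v
    using that parent_less[of u] parent_less[of v] by (auto simp: dominates_parent_graph_iff)
  show "\<exists>!r. r \<in> verts (parent_graph n f) \<and> in_degree (parent_graph n f) r = 0"
  proof (rule ex1I[of _ 0])
    show "0 \<in> verts (parent_graph n f) \<and> in_degree (parent_graph n f) 0 = 0"
      by (simp add: in_degree_parent_graph) (simp add: parent_graph_def)
  next
    fix r assume r: "r \<in> verts (parent_graph n f) \<and> in_degree (parent_graph n f) r = 0"
    then have "r \<le> n" by (simp add: parent_graph_def)
    then show "r = 0" using r in_degree_parent_graph[of r] by (simp split: if_splits)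
  qed
qed

text \<open>Parents are smaller than their children, so the largest vertex is nobody's parent. This
  provides the leaf that makes \<open>ell_s\<close> positive.\<close>

lemma last_leaf_parent_graph: "n \<in> leaves (parent_graph n f)"
proof -
  have "out_arcs (parent_graph n f) n = {}"
  proof (rule equals0I)
    fix e assume "e \<in> out_arcs (parent_graph n f) n"
    then have "e \<in> (\<lambda>v. (f v, v)) ` {1..n}" and n: "fst e = n"
      by (simp_all add: parent_graph_def)
    then obtain v where "v \<in> {1..n}" "e = (f v, v)" by blast
    then show False using n parent_less[of v] by simp
  qed
  then show ?thesis by (simp add: leaves_def out_degree_def) (simp add: parent_graph_def)
qed

end

section \<open>Bounding the maximum number of leaves\<close>

lemma leaves_subset_if_out_branching:
  "out_branching T D \<Longrightarrow> leaves T \<subseteq> verts D"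
  by (auto simp: out_branching_def spanning_def leaves_def)

text \<open>Makes the \<open>Max\<close> in \<open>ell_s\<close> a genuine maximum: every leaf
  number is bounded by the number of vertices.\<close>

lemma finite_leaf_numbers:
  assumes "finite (verts D)"
  shows "finite {card (leaves T) | T. out_branching T D}"
proof (rule finite_subset)
  show "{card (leaves T) | T. out_branching T D} \<subseteq> {..card (verts D)}"
    using assms by (auto dest!: leaves_subset_if_out_branching intro: card_mono)
qed simp

text \<open>If there is no out-branching, the default value 0 meets any bound.\<close>

lemma ell_s_le:
  assumes "finite (verts D)" "\<And>T. out_branching T D \<Longrightarrow> card (leaves T) \<le> k"
  shows "ell_s D \<le> k"
  using assms(2) finite_leaf_numbers[OF assms(1)] by (auto simp: ell_s_def)

lemma card_leaves_le_ell_s: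
  assumes "finite (verts D)" "out_branching T D"
  shows "card (leaves T) \<le> ell_s D"
  using assms(2) finite_leaf_numbers[OF assms(1)] by (auto simp: ell_s_def intro!: Max_ge)

section \<open>The digraph\<close>

text \<open>
  Vertex \<open>i * t + j\<close> with \<open>1 \<le> j \<le> t\<close> is the \<open>j\<close>-th vertex of the \<open>i\<close>-th path; vertex \<open>0\<close> has
  position \<open>0\<close> and belongs to all paths.
\<close>

definition path_index :: "nat \<Rightarrow> nat \<Rightarrow> nat" where
  "path_index t v = (v - 1) div t"

definition path_pos :: "nat \<Rightarrow> nat \<Rightarrow> nat" where
  "path_pos t v = (if v = 0 then 0 else (v - 1) mod t + 1)"

text \<open>\<open>path_index\<close> assigns index 0 to vertex 0; the disjuncts
  \<open>u = 0\<close> and \<open>v = 0\<close> are what place it on every path. The last disjunct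
  lets the positions from \<open>t - 3\<close> on reach their whole path.\<close>

definition H_arc :: "nat \<Rightarrow> nat \<Rightarrow> nat \<Rightarrow> bool" where
  "H_arc t u v \<longleftrightarrow> u \<noteq> v \<and> (u = 0 \<or> v = 0 \<or> path_index t u = path_index t v) \<and>
     (path_pos t v \<le> path_pos t u + 1 \<or> t \<le> path_pos t u + 3)"

definition H_graph :: "nat \<Rightarrow> (nat, nat \<times> nat) pre_digraph" where
  "H_graph t = \<lparr>verts = {..t\<^sup>2}, arcs = {(u, v). u \<le> t\<^sup>2 \<and> v \<le> t\<^sup>2 \<and> H_arc t u v},
     tail = fst, head = snd\<rparr>"

lemma verts_H_graph [simp]: "verts (H_graph t) = {..t\<^sup>2}"
  by (simp add: H_graph_def)

text \<open>Each path is followed forward from 0. The first vertex of a path is treated separately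
  because its numerical predecessor is in general the end of the previous path.\<close>

definition H_parent :: "nat \<Rightarrow> nat \<Rightarrow> nat" where
  "H_parent t v = (if path_pos t v = 1 then 0 else v - 1)"

section \<open>Coordinates on the paths\<close>

text \<open>Positions run from 1 to \<open>t\<close>, so \<open>v - 1\<close> rather than
  \<open>v\<close> is divided by \<open>t\<close>; the last vertex of a path thus stays in its own
  block.\<close>

lemma path_coordinates:
  assumes "1 \<le> j" "j \<le> t"
  shows "path_index t (i * t + j) = i" "path_pos t (i * t + j) = j"
proof -
  have "i * t + j - 1 = i * t + (j - 1)" "j - 1 < t" using assms by auto
  then have "(i * t + j - 1) div t = i" "(i * t + j - 1) mod t = j - 1"
    by (simp_all only: div_mult_self3 mod_mult_self3) auto
  then show "path_index t (i * t + j) = i" "path_pos t (i * t + j) = j"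
    using assms by (simp_all add: path_index_def path_pos_def)
qed

lemma path_pos_0 [simp]: "path_pos t 0 = 0"
  by (simp add: path_pos_def)

lemma path_coordinatesE:
  fixes t v :: nat
  assumes "1 \<le> v" "v \<le> t\<^sup>2"
  obtains i j where "v = i * t + j" "1 \<le> j" "j \<le> t" "i < t"
proof
  have "t > 0" using assms by (cases t) auto
  have "v - 1 = (v - 1) div t * t + (v - 1) mod t" by simp
  then show "v = (v - 1) div t * t + ((v - 1) mod t + 1)" using assms(1) by linarith
  show "(v - 1) mod t + 1 \<le> t" using \<open>t > 0\<close> by (simp add: Suc_le_eq)
  show "(v - 1) div t < t"
    using assms by (intro less_mult_imp_div_less) (auto simp: power2_eq_square)
  show "1 \<le> (v - 1) mod t + 1" by simp
qed

lemma path_vertex_le: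
  assumes "i < t" "j \<le> t"
  shows "i * t + j \<le> (t::nat)\<^sup>2"
proof -
  have "i * t + j \<le> Suc i * t" using assms by simp
  also have "\<dots> \<le> t * t" using assms by (intro mult_right_mono) auto
  finally show ?thesis by (simp add: power2_eq_square)
qed

section \<open>An out-branching and strong connectivity\<close>

lemma digraph_H_graph: "digraph (H_graph t)"
proof unfold_locales
  have "arcs (H_graph t) \<subseteq> {..t\<^sup>2} \<times> {..t\<^sup>2}" by (auto simp: H_graph_def)
  then show "finite (arcs (H_graph t))" by (rule finite_subset) simp
qed (auto simp: H_graph_def H_arc_def arc_to_ends_def)

lemma dominates_H_graph_iff:
  "u \<rightarrow>\<^bsub>H_graph t\<^esub> v \<longleftrightarrow> u \<le> t\<^sup>2 \<and> v \<le> t\<^sup>2 \<and> H_arc t u v"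
  by (force simp: arcs_ends_conv H_graph_def)

lemma H_parent_less: "1 \<le> v \<Longrightarrow> H_parent t v < v"
  by (auto simp: H_parent_def)

lemma H_arc_parent:
  assumes "1 \<le> v" "v \<le> t\<^sup>2"
  shows "H_arc t (H_parent t v) v"
proof -
  obtain i j where v: "v = i * t + j" and ij: "1 \<le> j" "j \<le> t" "i < t"
    using assms by (rule path_coordinatesE)
  have pos: "path_index t v = i" "path_pos t v = j" 
    using path_coordinates[OF ij(1,2), of i] by (simp_all only: v)
  show ?thesis
  proof (cases "j = 1")
    case True
    then show ?thesis using pos assms by (simp add: H_parent_def H_arc_def)
  next
    case False
    then have pred: "v - 1 = i * t + (j - 1)" "1 \<le> j - 1" "j - 1 \<le> t"
      using ij v by simp_all
    have "path_index t (v - 1) = i" "path_pos t (v - 1) = j - 1"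
      using path_coordinates[OF pred(2,3), of i] by (simp_all only: pred(1))
    moreover have "v - 1 \<noteq> v" "j \<le> j - 1 + 1" using assms(1) by linarith+
    ultimately show ?thesis using pos False by (simp add: H_parent_def H_arc_def)
  qed
qed

text \<open>This one out-branching serves twice: it shows that every vertex is reachable from 0, and
  that \<open>ell_s\<close> is positive.\<close>

lemma out_branching_H_parent:
  "out_branching (parent_graph (t\<^sup>2) (H_parent t)) (H_graph t)"
proof -
  let ?T = "parent_graph (t\<^sup>2) (H_parent t)"
  interpret T: digraph ?T by (rule digraph_parent_graph) (rule H_parent_less)
  interpret H: digraph "H_graph t" by (rule digraph_H_graph)
  have "H_parent t v \<le> t\<^sup>2" if "1 \<le> v" "v \<le> t\<^sup>2" for v
    using H_parent_less[of v t] that by simp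
  then have "arcs ?T \<subseteq> arcs (H_graph t)"
    by (auto simp: parent_graph_def H_graph_def H_arc_parent)
  then have "spanning ?T (H_graph t)"
    unfolding spanning_def subgraph_def compatible_def
    using T.wf_digraph H.wf_digraph by (auto simp: parent_graph_def H_graph_def)
  moreover have "out_tree ?T" by (rule out_tree_parent_graph) (rule H_parent_less)
  ultimately show ?thesis by (simp add: out_branching_def)
qed

text \<open>Position 0 is never ahead, so every other vertex has an arc to 0; from 0 the
  out-branching leads everywhere.\<close>

lemma strongly_connected_H_graph: "strongly_connected (H_graph t)"
proof (rule strongly_connectedI)
  interpret H: digraph "H_graph t" by (rule digraph_H_graph)
  show "verts (H_graph t) \<noteq> {}" by auto
  fix u v assume uv: "u \<in> verts (H_graph t)" "v \<in> verts (H_graph t)"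
  have "u \<rightarrow>\<^sup>*\<^bsub>H_graph t\<^esub> 0"
  proof (cases "u = 0")
    case False
    then have "u \<rightarrow>\<^bsub>H_graph t\<^esub> 0"
      using uv by (simp add: dominates_H_graph_iff H_arc_def)
    then show ?thesis by simp
  qed (use uv in simp)
  moreover have "0 \<rightarrow>\<^sup>*\<^bsub>H_graph t\<^esub> v"
  proof (rule pre_digraph.reachable_mono)
    show "0 \<rightarrow>\<^sup>*\<^bsub>parent_graph (t\<^sup>2) (H_parent t)\<^esub> v"
      using uv by (intro reachable_parent_graph H_parent_less) simp_all
    show "subgraph (parent_graph (t\<^sup>2) (H_parent t)) (H_graph t)"
      using out_branching_H_parent by (simp add: out_branching_def spanning_def)
  qed
  ultimately show "u \<rightarrow>\<^sup>*\<^bsub>H_graph t\<^esub> v" by (rule H.reachable_trans)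
qed

section \<open>In-degrees\<close>

lemma in_degree_H_graph:
  assumes "v \<le> t\<^sup>2"
  shows "in_degree (H_graph t) v = card {u. u \<le> t\<^sup>2 \<and> H_arc t u v}"
proof -
  have "in_arcs (H_graph t) v = (\<lambda>u. (u, v)) ` {u. u \<le> t\<^sup>2 \<and> H_arc t u v}"
    using assms by (auto simp: in_arcs_def H_graph_def)
  moreover have "inj_on (\<lambda>u. (u, v)) {u. u \<le> t\<^sup>2 \<and> H_arc t u v}"
    by (simp add: inj_on_def)
  ultimately show ?thesis by (simp only: in_degree_def card_image)
qed

text \<open>The last four vertices of a path send arcs to all other vertices of the path and to 0,
  and at most one of the four is \<open>v\<close> itself. For \<open>v = 0\<close> the path of index
  0 is used.\<close>

lemma in_degree_H_graph_ge:
  assumes "6 \<le> t" "v \<le> t\<^sup>2"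
  shows "3 \<le> in_degree (H_graph t) v"
proof -
  define i where "i = path_index t v"
  have "i < t"
  proof (cases "v = 0")
    case False
    then have "1 \<le> v" by simp
    then obtain i' j where "v = i' * t + j" "1 \<le> j" "j \<le> t" "i' < t"
      using assms(2) by (rule path_coordinatesE)
    then show ?thesis by (simp add: i_def path_coordinates)
  qed (use assms in \<open>simp add: i_def path_index_def\<close>)
  let ?K = "(\<lambda>j. i * t + j) ` {t - 3..t}"
  have "card ?K = 4" using assms(1) by (simp add: card_image)
  moreover have "card ?K - card {v} \<le> card (?K - {v})" by (rule diff_card_le_card_Diff) simp
  ultimately have "3 \<le> card (?K - {v})" by simp
  also have "\<dots> \<le> card {u. u \<le> t\<^sup>2 \<and> H_arc t u v}"
  proof (rule card_mono)
    show "?K - {v} \<subseteq> {u. u \<le> t\<^sup>2 \<and> H_arc t u v}"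
    proof
      fix u assume "u \<in> ?K - {v}"
      then obtain j where "u = i * t + j" "t - 3 \<le> j" "j \<le> t" "u \<noteq> v"
        by (elim DiffE imageE) simp
      then have "path_index t u = i" "path_pos t u = j" "u \<le> t\<^sup>2" "t \<le> j + 3"
        using assms(1) path_coordinates[of j t i] path_vertex_le[OF \<open>i < t\<close>, of j] by simp_all
      then show "u \<in> {u. u \<le> t\<^sup>2 \<and> H_arc t u v}"
        using \<open>u \<noteq> v\<close> by (simp add: H_arc_def i_def)
    qed
  qed simp
  also have "\<dots> = in_degree (H_graph t) v" using assms(2) by (simp add: in_degree_H_graph)
  finally show ?thesis .
qed

text \<open>Vertex \<open>t\<close> ends the path of index 0. Both a single forward step and an arc
  from the last four positions start at \<open>t - 3\<close> or later, and 0 is too far back, so the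
  lower bound 3 is attained here.\<close>

lemma in_degree_H_graph_path_end:
  assumes "6 \<le> t"
  shows "in_degree (H_graph t) t = 3"
proof -
  have t: "path_index t t = 0" "path_pos t t = t"
    using path_coordinates[of t t 0] assms by auto
  have "u \<in> {t - 3, t - 2, t - 1}" if u: "u \<le> t\<^sup>2" "H_arc t u t" for u
  proof -
    have "u \<noteq> 0"
    proof
      assume "u = 0"
      then show False using u(2) assms t by (simp add: H_arc_def)
    qed
    then have "1 \<le> u" by simp
    then obtain i j where "u = i * t + j" "1 \<le> j" "j \<le> t" "i < t"
      using u(1) by (rule path_coordinatesE)
    moreover from this have "path_index t u = i" "path_pos t u = j"
      using path_coordinates by simp_all
    then have "i = 0" "t \<le> j + 3" "u \<noteq> t"
      using u(2) t \<open>u \<noteq> 0\<close> assms by (auto simp: H_arc_def)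
    ultimately show ?thesis by auto
  qed
  then have "{u. u \<le> t\<^sup>2 \<and> H_arc t u t} \<subseteq> {t - 3, t - 2, t - 1}" by blast
  then have "card {u. u \<le> t\<^sup>2 \<and> H_arc t u t} \<le> card {t - 3, t - 2, t - 1}"
    by (intro card_mono) auto
  also have "\<dots> \<le> 3" by (simp add: card_insert_if)
  finally have "in_degree (H_graph t) t \<le> 3"
    by (simp add: in_degree_H_graph power2_eq_square)
  then show ?thesis
    using in_degree_H_graph_ge[OF assms, of t] by (simp add: power2_eq_square)
qed

lemma min_in_degree_H_graph:
  assumes "6 \<le> t"
  shows "min_in_degree (H_graph t) = 3"
  unfolding min_in_degree_def
proof (rule Min_eqI)
  have "t \<in> verts (H_graph t)" by (simp add: power2_eq_square)
  then show "3 \<in> in_degree (H_graph t) ` verts (H_graph t)"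
    using in_degree_H_graph_path_end[OF assms] by (metis image_eqI)
qed (use in_degree_H_graph_ge[OF assms] in auto)

section \<open>The upper bound on the number of leaves\<close>

text \<open>Some tree arc must enter the segment of path \<open>i\<close> beyond position
  \<open>j\<close>, as the root is not there. Among the vertices outside this segment only the one
  at position \<open>j\<close> has an arc into it, so it has a child.\<close>

lemma not_leaf_if_root_on_other_path:
  assumes "6 \<le> t" "out_branching T (H_graph t)"
    and root: "\<And>v. v \<in> verts T \<Longrightarrow> in_degree T v = 0 \<Longrightarrow> v = r"
    and "i < t" "1 \<le> j" "j + 3 < t" "r \<notin> {i * t + k | k. 1 \<le> k \<and> k \<le> t}"
  shows "i * t + j \<notin> leaves T"
proof -
  interpret T: digraph T
    using assms(2) by (simp add: out_branching_def out_tree_def oriented_tree_def)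
  have sub: "verts T = {..t\<^sup>2}" "arcs T \<subseteq> arcs (H_graph t)"
      "tail T = tail (H_graph t)" "head T = head (H_graph t)"
    using assms(2)
    by (auto simp: out_branching_def spanning_def subgraph_def compatible_def H_graph_def)
  have "acyclic (arcs_ends T)"
    using assms(2) T.digraph_axioms
    by (intro oriented_underlying_acyclic_imp_acyclic)
      (auto simp: out_branching_def out_tree_def oriented_tree_def underlying_tree_def)
  let ?S = "{i * t + k | k. j < k \<and> k \<le> t}"
  have "?S \<subseteq> verts T" using assms(4) by (auto simp: sub path_vertex_le)
  have "i * t + t \<in> ?S" using assms(6) by auto
  then have "?S \<noteq> {}" by blast
  have rootless: "in_degree T v \<noteq> 0" if "v \<in> ?S" for v
  proof
    assume "in_degree T v = 0"
    then have "v = r" using root that \<open>?S \<subseteq> verts T\<close> by blast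
    then show False using that assms(5,7) by fastforce
  qed
  obtain u v where uv: "u \<rightarrow>\<^bsub>T\<^esub> v" "v \<in> ?S" "u \<notin> ?S"
    by (rule arc_enters_rootless_set[OF T.digraph_axioms \<open>acyclic (arcs_ends T)\<close>
        \<open>?S \<subseteq> verts T\<close> \<open>?S \<noteq> {}\<close> rootless])
  obtain e where e: "e \<in> arcs T" "tail T e = u" "head T e = v" using uv(1) by blast
  then have "H_arc t u v" "u \<le> t\<^sup>2"
    using sub by (auto simp: H_graph_def)
  obtain k where k: "v = i * t + k" "j < k" "k \<le> t" using uv(2) by auto
  then have v: "path_index t v = i" "path_pos t v = k" by (simp_all add: path_coordinates)
  have "u \<noteq> 0"
  proof
    assume "u = 0"
    \<comment> \<open>Since \<open>1 \<le> j < k\<close>, position \<open>k\<close> is at least 2,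
      while vertex 0 reaches only position 1 when \<open>t \<ge> 6\<close>.\<close>
    then show False using \<open>H_arc t u v\<close> v k assms(1,5) by (simp add: H_arc_def)
  qed
  then have "1 \<le> u" by simp
  then obtain i' l where u: "u = i' * t + l" "1 \<le> l" "l \<le> t"
    using \<open>u \<le> t\<^sup>2\<close> by (rule path_coordinatesE)
  have "path_index t u = i'" "path_pos t u = l" using u by (simp_all add: path_coordinates)
  then have "i' = i" and step: "k \<le> l + 1 \<or> t \<le> l + 3"
    using \<open>H_arc t u v\<close> \<open>u \<noteq> 0\<close> v k by (auto simp: H_arc_def)
  have "l \<le> j"
  proof (rule ccontr)
    assume "\<not> l \<le> j"
    then have "u \<in> ?S" using u \<open>i' = i\<close> by auto
    then show False using uv(3) by simp
  qed
  \<comment> \<open>By \<open>l \<le> j\<close> and \<open>j + 3 < t\<close>, the tail is not among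
    the last four positions. Hence the arc is a single forward step, and
    \<open>j < k \<le> l + 1\<close> leaves only \<open>l = j\<close>.\<close>
  then have "l = j" using step k(2) assms(6) by linarith
  then have "e \<in> out_arcs T (i * t + j)" using e u \<open>i' = i\<close> by simp
  then have "out_degree T (i * t + j) \<noteq> 0"
    unfolding out_degree_def using T.finite_out_arcs by (metis card_0_eq empty_iff)
  then show ?thesis by (simp add: leaves_def)
qed

text \<open>Possible leaves are 0, the \<open>t\<close> vertices on the path of the root, and the
  last four vertices of each of the \<open>t\<close> paths. This gives at most
  \<open>1 + t + 4 * t\<close>, hence at most \<open>6 * t\<close>.\<close>

lemma card_leaves_H_graph_le:
  assumes "6 \<le> t" "out_branching T (H_graph t)"
  shows "card (leaves T) \<le> 6 * t"
proof -
  obtain r where r: "\<And>v. v \<in> verts T \<Longrightarrow> in_degree T v = 0 \<Longrightarrow> v = r"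
    using assms(2) unfolding out_branching_def out_tree_def by blast
  \<comment> \<open>If the root is 0, then \<open>A\<close> is the path of index 0. The inclusion
    below still holds, because then no path contains the root among its positions 1 to
    \<open>t\<close>, and all nonzero leaves lie in \<open>B\<close>.\<close>
  define A where "A = (\<lambda>j. path_index t r * t + j) ` {1..t}"
  define B where "B = (\<lambda>(i, j). i * t + j) ` ({..<t} \<times> {t - 3..t})"
  have "leaves T \<subseteq> insert 0 (A \<union> B)"
  proof
    fix v assume v: "v \<in> leaves T"
    then have "v \<le> t\<^sup>2"
      using leaves_subset_if_out_branching[OF assms(2)] by auto
    show "v \<in> insert 0 (A \<union> B)"
    proof (cases "v = 0")
      case False
      then have "1 \<le> v" by simp
      then obtain i j where ij: "v = i * t + j" "1 \<le> j" "j \<le> t" "i < t"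
        using \<open>v \<le> t\<^sup>2\<close> by (rule path_coordinatesE)
      show ?thesis
      proof (cases "j + 3 < t")
        case True
        then have "r \<in> {i * t + k | k. 1 \<le> k \<and> k \<le> t}"
          using not_leaf_if_root_on_other_path[OF assms r ij(4,2)] ij(1) v by blast
        then have "path_index t r = i" by (auto simp: path_coordinates)
        then have "v \<in> A" unfolding A_def using ij by (intro image_eqI[of _ _ j]) simp_all
        then show ?thesis by blast
      next
        case False
        then have "(i, j) \<in> {..<t} \<times> {t - 3..t}" using ij by auto
        then have "v \<in> B" unfolding B_def using ij(1) by (intro image_eqI[of _ _ "(i, j)"]) simp_all
        then show ?thesis by blast
      qed
    qed simp
  qed
  then have "card (leaves T) \<le> card (insert 0 (A \<union> B))"
    by (rule card_mono[rotated]) (simp add: A_def B_def)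
  also have "\<dots> \<le> Suc (card (A \<union> B))" by (simp add: card_insert_if A_def B_def)
  also have "card (A \<union> B) \<le> card A + card B" by (rule card_Un_le)
  also have "card A \<le> t" unfolding A_def by (rule card_image_le[THEN order_trans]) auto
  also have "card B \<le> t * 4"
    unfolding B_def using assms(1)
    by (intro card_image_le[THEN order_trans]) (auto simp: card_cartesian_product)
  finally show ?thesis using assms(1) by simp
qed

theorem theorem6:
  shows "\<exists>C::real. C > 0 \<and>
    (\<forall>t::nat. t \<ge> 6 \<longrightarrow>
      (\<exists>H :: (nat, nat \<times> nat) pre_digraph.
         digraph H \<and> strongly_connected H \<and> card (verts H) = t ^ 2 + 1 \<and>
         min_in_degree H = 3 \<and>
         0 < ell_s H \<and> real (ell_s H) \<le> C * real t))"
proof (intro exI[of _ 6] conjI allI impI)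
  fix t :: nat assume t: "6 \<le> t"
  let ?T = "parent_graph (t\<^sup>2) (H_parent t)"
  have fin: "finite (verts (H_graph t))" by simp
  \<comment> \<open>A single leaf of one out-branching suffices for positivity; the largest vertex
    is such a leaf.\<close>
  have "t\<^sup>2 \<in> leaves ?T" by (rule last_leaf_parent_graph) (rule H_parent_less)
  moreover have "finite (leaves ?T)"
    using leaves_subset_if_out_branching[OF out_branching_H_parent] fin by (rule finite_subset)
  ultimately have "0 < card (leaves ?T)" by (auto simp: card_gt_0_iff)
  also have "\<dots> \<le> ell_s (H_graph t)"
    using fin out_branching_H_parent by (rule card_leaves_le_ell_s)
  finally have "0 < ell_s (H_graph t)" .
  moreover have "ell_s (H_graph t) \<le> 6 * t"
    using fin card_leaves_H_graph_le[OF t] by (rule ell_s_le)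
  then have "real (ell_s (H_graph t)) \<le> 6 * real t" by linarith
  moreover have "card (verts (H_graph t)) = t\<^sup>2 + 1" by simp
  ultimately show "\<exists>H :: (nat, nat \<times> nat) pre_digraph.
         digraph H \<and> strongly_connected H \<and> card (verts H) = t ^ 2 + 1 \<and>
         min_in_degree H = 3 \<and> 0 < ell_s H \<and> real (ell_s H) \<le> 6 * real t"
    using digraph_H_graph strongly_connected_H_graph min_in_degree_H_graph[OF t] by blast
qed simp

end
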